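(* Let $\mu,\nu$ be Borel probability measures on $\mathbb{R}$ with $\mu\preceq_{\mathrm{st}}\nu$. For $x\in\mathbb{R}$ let $S_x=\{\theta:\ \mu|_{(x,\infty)}\preceq_{\mathrm{st}}\theta\le\nu\}$, where $\theta$ ranges over subprobability measures on $\mathbb{R}$, and let $\nu_x$ be the subprobability measure defined by its cdf $F_{\nu_x}=\sup_{\theta\in S_x}F_\theta$ (pointwise supremum). Then there exists a unique directional coupling $P_*=P_*(\mu,\nu)$ of $\mu$ and $\nu$ which couples $\mu|_{(x,\infty)}$ to $\nu_x$ for all $x\in\mathbb{R}$, i.e. $P_*((x,\infty)\times B)=\nu_x(B)$ for all $x\in\mathbb{R}$ and Borel $B\subseteq\mathbb{R}$. Moreover, for every $x\in\mathbb{R}$, $\nu_x$ is the unique minimal element of $S_x$ for the order $\preceq_{\mathrm{st}}$ (that is, $\nu_x\in S_x$ and $\nu_x\preceq_{\mathrm{st}}\theta$ for all $\theta\in S_x$).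
   Context: For a finite Borel measure $\theta$ on $\mathbb{R}$, $F_\theta(t)=\theta((-\infty,t])$ is its cdf. For finite measures $\theta_1,\theta_2$ on $\mathbb{R}$, $\theta_1\preceq_{\mathrm{st}}\theta_2$ means $\theta_1(\mathbb{R})=\theta_2(\mathbb{R})$ and $F_{\theta_1}\ge F_{\theta_2}$ pointwise. $\theta\le\nu$ means $\theta(A)\le\nu(A)$ for all Borel $A$. $\mu|_A$ denotes the restriction $\mu(\cdot\cap A)$. A coupling of $\mu,\nu$ is a probability measure on $\mathbb{R}^2$ with first marginal $\mu$ and second marginal $\nu$; it is directional if it is concentrated on $\mathbb{H}=\{(x,y)\in\mathbb{R}^2: y\ge x\}$. *)

theory Defs
  imports "HOL-Probability.Probability"
begin

text \<open>
  A Borel probability measure on the line is a \<^locale>\<open>real_distribution\<close>, and \<^const>\<open>cdf\<close> is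
  the library's distribution function.
\<close>

text \<open>The measure \<open>B \<mapsto> M (B \<inter> A)\<close>, still on the Borel sets of the whole line, unlike
  \<^const>\<open>restrict_space\<close>, which changes the underlying space.\<close>

definition restr_meas :: "real measure \<Rightarrow> real set \<Rightarrow> real measure" where
  "restr_meas M A = density M (indicator A)"

lemma emeasure_restr_meas:
  assumes "A \<in> sets M" and "B \<in> sets M"
  shows "emeasure (restr_meas M A) B = emeasure M (B \<inter> A)"
  using assms by (simp add: restr_meas_def emeasure_restricted Int_commute)

text \<open>Stochastic order. It is used only for finite Borel measures on the line.\<close>

definition st_le :: "real measure \<Rightarrow> real measure \<Rightarrow> bool"  (infix "\<preceq>\<^sub>s\<^sub>t" 50) where
  "\<theta>\<^sub>1 \<preceq>\<^sub>s\<^sub>t \<theta>\<^sub>2 \<longleftrightarrow> measure \<theta>\<^sub>1 UNIV = measure \<theta>\<^sub>2 UNIV \<and> (\<forall>t. cdf \<theta>\<^sub>1 t \<ge> cdf \<theta>\<^sub>2 t)"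

text \<open>The library order on measures compares spaces and sigma-algebras first; as \<open>\<theta>\<close> and \<open>\<nu>\<close> are
  both Borel, \<open>\<theta> \<le> \<nu>\<close> here is the setwise order (see \<open>le_measure\<close>).\<close>

definition S_set :: "real measure \<Rightarrow> real measure \<Rightarrow> real \<Rightarrow> real measure set" where
  "S_set \<mu> \<nu> x =
     {\<theta>. sets \<theta> = sets borel \<and> subprob_space \<theta> \<and> restr_meas \<mu> {x<..} \<preceq>\<^sub>s\<^sub>t \<theta> \<and> \<theta> \<le> \<nu>}"

text \<open>A finite Borel measure is determined by its cdf, so the description has at most one solution.
  That it has one is part of what has to be proved: a least element of \<open>S_set \<mu> \<nu> x\<close> is
  necessarily such a solution.\<close>

definition nu_meas :: "real measure \<Rightarrow> real measure \<Rightarrow> real \<Rightarrow> real measure" where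
  "nu_meas \<mu> \<nu> x =
     (THE \<eta>. sets \<eta> = sets borel \<and> subprob_space \<eta> \<and>
             (\<forall>t. cdf \<eta> t = (SUP \<theta>\<in>S_set \<mu> \<nu> x. cdf \<theta> t)))"

definition coupling :: "real measure \<Rightarrow> real measure \<Rightarrow> (real \<times> real) measure \<Rightarrow> bool" where
  "coupling \<mu> \<nu> P \<longleftrightarrow>
     sets P = sets borel \<and> prob_space P \<and> distr P borel fst = \<mu> \<and> distr P borel snd = \<nu>"

definition directional :: "(real \<times> real) measure \<Rightarrow> bool" where
  "directional P \<longleftrightarrow> (AE p in P. p \<in> {(x, y). y \<ge> x})"

end

theory Submission
  imports Defs
begin

text \<open>
  Write \<open>F\<close> and \<open>G\<close> for the distribution functions of \<open>\<mu>\<close> and \<open>\<nu>\<close>, and \<open>gap = F - G\<close>, which is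
  nonnegative because of the stochastic order. Everything rests on an explicit formula for
  \<open>\<nu>\<^sub>x\<close>: for \<open>t \<ge> x\<close> its distribution function is
  \<open>G t - F x + (INF s\<in>{x..t}. gap s)\<close>, and it is \<open>0\<close> for \<open>t \<le> x\<close>.
  
  The formula is forced from above. If \<open>\<theta>\<close> is admissible, then up to \<open>s\<close> it carries at most the mass
  \<open>F s - F x\<close> of \<open>\<mu>\<close> on \<open>(x, s]\<close>, and on \<open>(s, t]\<close> it carries at most the mass \<open>G t - G s\<close> of \<open>\<nu>\<close>;
  minimising the sum of the two bounds over \<open>s\<close> gives the formula (\<open>cdf_le_shadow_cdf\<close>).
  Conversely the formula defines the distribution function of an admissible measure, called
  \<open>shadow x\<close> below: it increases, but on no interval by more than \<open>G\<close> does, and since \<open>gap\<close>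
  vanishes at infinity the total mass is \<open>1 - F x\<close> (\<open>shadow_in_S_set\<close>). So the pointwise supremum
  is attained by one measure, which is then the least admissible one.
  
  The running minimum from \<open>x\<close> is the running minimum from a later \<open>y\<close>, cut off at a constant level.
  Hence \<open>shadow y \<le> shadow x\<close> setwise for \<open>x \<le> y\<close> (\<open>shadow_antimono\<close>).
  This is all that is needed for a coupling: a family \<open>K\<close> of
  submeasures of \<open>\<nu>\<close> that decreases in \<open>x\<close> and has masses \<open>\<mu> (x, \<infinity>)\<close> always has the form
  \<open>K x B = P ((x, \<infinity>) \<times> B)\<close> (\<open>ex_coupling_of_antimono_family\<close>). Indeed the density \<open>f x y\<close> of \<open>K x\<close>
  with respect to \<open>\<nu>\<close> should be the conditional probability of \<open>(x, \<infinity>)\<close> given the second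
  coordinate \<open>y\<close>, and a random point with these tail probabilities is obtained by comparing the
  densities with one uniform variable. Directionality says that \<open>shadow x\<close> does not charge
  \<open>(-\<infinity>, x]\<close>, and uniqueness holds because the sets \<open>(x, \<infinity>) \<times> B\<close> are an intersection-stable
  generator of the Borel sets of the plane.
\<close>

section \<open>Finite measures on the line and their distribution functions\<close>

text \<open>
  The difference of the two distribution functions is again nondecreasing and right continuous, so
  it is the distribution function of a measure \<open>\<rho>\<close>, and \<open>\<theta> + \<rho>\<close> agrees with \<open>\<eta>\<close> on half-open
  intervals, hence everywhere. (A monotone class argument applied directly to the inequality would
  fail, as setwise inequalities do not pass to proper differences.)
\<close>

lemma le_measure_if_cdf_increments_le:
  assumes "finite_borel_measure \<theta>" and "finite_borel_measure \<eta>"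
    and incr: "\<And>a b. a \<le> b \<Longrightarrow> cdf \<theta> b - cdf \<theta> a \<le> cdf \<eta> b - cdf \<eta> a"
  shows "\<theta> \<le> \<eta>"
proof -
  interpret \<theta>: finite_borel_measure \<theta> by fact
  interpret \<eta>: finite_borel_measure \<eta> by fact
  define \<rho> where "\<rho> = interval_measure (\<lambda>t. cdf \<eta> t - cdf \<theta> t)"
  define \<sigma> where "\<sigma> = measure_of UNIV (sets borel) (\<lambda>A. emeasure \<theta> A + emeasure \<rho> A)"
  have sets_\<rho>: "sets \<rho> = sets borel" by (simp add: \<rho>_def)
  have \<rho>_Ioc: "emeasure \<rho> {a<..b} = ennreal ((cdf \<eta> b - cdf \<theta> b) - (cdf \<eta> a - cdf \<theta> a))"
    if "a \<le> b" for a b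
    unfolding \<rho>_def
  proof (rule emeasure_interval_measure_Ioc[OF that])
    show "cdf \<eta> x - cdf \<theta> x \<le> cdf \<eta> y - cdf \<theta> y" if "x \<le> y" for x y
      using incr[OF that] by linarith
    show "continuous (at_right a) (\<lambda>t. cdf \<eta> t - cdf \<theta> t)" for a
      by (intro continuous_diff \<theta>.cdf_is_right_cont \<eta>.cdf_is_right_cont)
  qed
  have sets_\<sigma>: "sets \<sigma> = sets borel"
    using sets.sets_measure_of_eq[of borel] unfolding \<sigma>_def by simp
  have \<sigma>: "emeasure \<sigma> A = emeasure \<theta> A + emeasure \<rho> A" if "A \<in> sets borel" for A
    unfolding \<sigma>_def
  proof (rule emeasure_measure_of_sigma[OF _ _ _ that])
    show "sigma_algebra UNIV (sets borel)"
      using sets.sigma_algebra_axioms[of borel] by simp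
    show "countably_additive (sets borel) (\<lambda>A. emeasure \<theta> A + emeasure \<rho> A)"
    proof (rule countably_additiveI)
      fix A :: "nat \<Rightarrow> real set"
      assume A: "range A \<subseteq> sets borel" "disjoint_family A"
      have "(\<Sum>i. emeasure \<theta> (A i) + emeasure \<rho> (A i))
          = (\<Sum>i. emeasure \<theta> (A i)) + (\<Sum>i. emeasure \<rho> (A i))"
        by (rule suminf_add[symmetric]) auto
      then show "(\<Sum>i. emeasure \<theta> (A i) + emeasure \<rho> (A i))
          = emeasure \<theta> (\<Union> (range A)) + emeasure \<rho> (\<Union> (range A))"
        using A by (simp add: suminf_emeasure \<theta>.M_is_borel sets_\<rho>)
    qed
  qed (simp add: positive_def)
  have "\<eta> = \<sigma>"
  proof (rule measure_eqI_generator_eq[where \<Omega> = UNIV and A = "\<lambda>i. {- real i<..real i}"])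
    fix X assume "X \<in> range (\<lambda>(a, b). {a<..b::real})"
    then obtain a b where X: "X = {a<..b}" by auto
    show "emeasure \<eta> X = emeasure \<sigma> X"
    proof (cases "a \<le> b")
      case True
      have "0 \<le> cdf \<theta> b - cdf \<theta> a" "0 \<le> (cdf \<eta> b - cdf \<theta> b) - (cdf \<eta> a - cdf \<theta> a)"
        using \<theta>.cdf_nondecreasing[OF True] incr[OF True] by linarith+
      then show ?thesis
        unfolding X using True
        by (simp add: \<sigma> \<theta>.emeasure_Ioc \<eta>.emeasure_Ioc \<rho>_Ioc ennreal_plus[symmetric]
            del: ennreal_plus)
    qed (simp add: X)
  next
    show "(\<Union>i. {- real (i::nat)<..real i}) = UNIV"
      by (rule UN_Ioc_eq_UNIV)
  qed (auto simp: \<eta>.M_is_borel sets_\<sigma> borel_sigma_sets_Ioc Int_stable_def \<eta>.emeasure_finite)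
  then show ?thesis
    by (auto simp: le_measure \<theta>.M_is_borel \<eta>.M_is_borel \<sigma> sets_\<sigma>)
qed

lemma increments_le_if_le_measure:
  assumes "finite_borel_measure \<theta>" and "finite_borel_measure \<eta>" and "\<theta> \<le> \<eta>" and "a \<le> b"
  shows "cdf \<theta> b - cdf \<theta> a \<le> cdf \<eta> b - cdf \<eta> a"
proof -
  interpret \<theta>: finite_borel_measure \<theta> by fact
  interpret \<eta>: finite_borel_measure \<eta> by fact
  have "emeasure \<theta> {a<..b} \<le> emeasure \<eta> {a<..b}"
    using assms(3) by (rule le_measureD3) (simp add: \<theta>.M_is_borel \<eta>.M_is_borel)
  moreover have "cdf \<eta> a \<le> cdf \<eta> b"
    using assms(4) by (rule \<eta>.cdf_nondecreasing)
  ultimately show ?thesis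
    using assms(4) by (simp add: \<theta>.emeasure_Ioc \<eta>.emeasure_Ioc ennreal_le_iff)
qed

lemma st_le_antisym:
  assumes "finite_borel_measure \<theta>" and "finite_borel_measure \<eta>"
    and "\<theta> \<preceq>\<^sub>s\<^sub>t \<eta>" and "\<eta> \<preceq>\<^sub>s\<^sub>t \<theta>"
  shows "\<theta> = \<eta>"
proof (rule cdf_unique'[OF assms(1,2)])
  show "cdf \<theta> = cdf \<eta>"
    using assms(3,4) by (auto simp: st_le_def fun_eq_iff intro: order.antisym)
qed

lemma (in real_distribution) measure_greaterThan:
  "measure M {x<..} = 1 - cdf M x"
proof -
  have "{x<..} = space M - {..x}" by auto
  then show ?thesis
    by (simp add: prob_compl cdf_def del: space_eq_univ)
qed

lemma (in real_distribution) restr_meas_greaterThan: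
  shows "measure (restr_meas M {x<..}) UNIV = 1 - cdf M x"
    and "cdf (restr_meas M {x<..}) t = cdf M (max x t) - cdf M x"
proof -
  have 1: "measure (restr_meas M {x<..}) B = measure M (B \<inter> {x<..})" if "B \<in> sets borel" for B
    using that by (simp add: measure_def emeasure_restr_meas)
  show "measure (restr_meas M {x<..}) UNIV = 1 - cdf M x"
    using 1[of UNIV] by (simp add: measure_greaterThan)
  have "{..t} \<inter> {x<..} = {x<..max x t}" by auto
  moreover have "measure M {x<..max x t} = cdf M (max x t) - cdf M x"
    by (cases "x < max x t") (auto simp: cdf_diff_eq max_def)
  ultimately show "cdf (restr_meas M {x<..}) t = cdf M (max x t) - cdf M x"
    using 1[of "{..t}"] by (simp add: cdf_def)
qed

section \<open>The running minimum of the gap between two distribution functions\<close>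

locale st_ordered_pair =
  \<mu>: real_distribution \<mu> + \<nu>: real_distribution \<nu> for \<mu> \<nu> :: "real measure" +
  assumes st_le: "\<mu> \<preceq>\<^sub>s\<^sub>t \<nu>"
begin

definition gap :: "real \<Rightarrow> real" where
  "gap s = cdf \<mu> s - cdf \<nu> s"

text \<open>
  For \<open>s\<close> between \<open>x\<close> and \<open>t\<close>, \<open>gap s\<close> is, up to the constant \<open>G t - F x\<close>, the bound on the mass
  below \<open>t\<close> obtained by splitting at \<open>s\<close>; its running minimum is the best of these bounds.
\<close>

definition min_gap :: "real \<Rightarrow> real \<Rightarrow> real" where
  "min_gap x t = (INF s\<in>{x..t}. gap s)"

text \<open>
  The use of \<open>max x t\<close> makes the function constant left of \<open>x\<close>, where its value is
  \<open>G x - F x + gap x = 0\<close>.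
\<close>

definition shadow_cdf :: "real \<Rightarrow> real \<Rightarrow> real" where
  "shadow_cdf x t = cdf \<nu> (max x t) - cdf \<mu> x + min_gap x (max x t)"

lemma gap_nonneg: "0 \<le> gap s"
  using st_le by (simp add: st_le_def gap_def)

lemma bdd_below_gap: "bdd_below (gap ` A)"
  using gap_nonneg by (auto intro!: bdd_belowI[where m = 0])

lemma min_gap_le: "x \<le> s \<Longrightarrow> s \<le> t \<Longrightarrow> min_gap x t \<le> gap s"
  unfolding min_gap_def by (rule cINF_lower[OF bdd_below_gap]) auto

lemma min_gap_greatest: "x \<le> t \<Longrightarrow> (\<And>s. x \<le> s \<Longrightarrow> s \<le> t \<Longrightarrow> c \<le> gap s) \<Longrightarrow> c \<le> min_gap x t"
  unfolding min_gap_def by (rule cINF_greatest) auto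

lemma min_gap_nonneg: "x \<le> t \<Longrightarrow> 0 \<le> min_gap x t"
  by (rule min_gap_greatest) (auto simp: gap_nonneg)

lemma min_gap_refl [simp]: "min_gap x x = gap x"
  by (simp add: min_gap_def)

lemma min_gap_split:
  assumes "x \<le> y" "y \<le> t"
  shows "min_gap x t = min (min_gap x y) (min_gap y t)"
proof -
  have "{x..t} = {x..y} \<union> {y..t}" using assms by auto
  then show ?thesis
    unfolding min_gap_def inf_min[symmetric] using assms
    by (simp add: cINF_union bdd_below_gap)
qed

text \<open>
  The gap decreases no faster than \<open>G\<close> increases, because \<open>F\<close> is nondecreasing. This is what makes
  \<^term>\<open>shadow_cdf x\<close> nondecreasing.
\<close>

lemma gap_le_min_gap: "t \<le> u \<Longrightarrow> gap t + cdf \<nu> t \<le> min_gap t u + cdf \<nu> u"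
proof -
  assume "t \<le> u"
  then have "gap t + cdf \<nu> t - cdf \<nu> u \<le> min_gap t u"
  proof (rule min_gap_greatest)
    fix s assume "t \<le> s" "s \<le> u"
    then show "gap t + cdf \<nu> t - cdf \<nu> u \<le> gap s"
      using \<mu>.cdf_nondecreasing[of t s] \<nu>.cdf_nondecreasing[of s u] by (simp add: gap_def)
  qed
  then show ?thesis by simp
qed

lemma shadow_cdf_eq_0: "t \<le> x \<Longrightarrow> shadow_cdf x t = 0"
  by (simp add: shadow_cdf_def max_def gap_def)

lemma shadow_cdf_max: "shadow_cdf x (max x t) = shadow_cdf x t"
  by (simp add: shadow_cdf_def)

lemma shadow_cdf_ge: "x \<le> t \<Longrightarrow> shadow_cdf x t = cdf \<nu> t - cdf \<mu> x + min_gap x t"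
  by (simp add: shadow_cdf_def max_def)

lemma shadow_cdf_mono: "a \<le> b \<Longrightarrow> shadow_cdf x a \<le> shadow_cdf x b"
proof -
  assume "a \<le> b"
  define m n where "m = max x a" and "n = max x b"
  have "x \<le> m" "m \<le> n" using \<open>a \<le> b\<close> by (auto simp: m_def n_def)
  then have "min_gap x m + cdf \<nu> m \<le> min_gap x n + cdf \<nu> n"
    using min_gap_split[of x m n] gap_le_min_gap[of m n] min_gap_le[of x m m] \<nu>.cdf_nondecreasing[of m n]
    by (simp add: min_def)
  then show ?thesis by (simp add: shadow_cdf_def m_def n_def)
qed

lemma shadow_cdf_increment_le:
  assumes "a \<le> b"
  shows "shadow_cdf x b - shadow_cdf x a \<le> cdf \<nu> b - cdf \<nu> a"
proof (cases "b \<le> x")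
  case True
  then show ?thesis using assms \<nu>.cdf_nondecreasing[of a b] by (simp add: shadow_cdf_eq_0)
next
  case False
  then have "min_gap x b \<le> min_gap x (max x a)"
    using assms min_gap_split[of x "max x a" b] by simp
  moreover have "cdf \<nu> a \<le> cdf \<nu> (max x a)"
    by (rule \<nu>.cdf_nondecreasing) simp
  ultimately show ?thesis
    using False by (simp add: shadow_cdf_def max_absorb2)
qed

text \<open>
  Beyond \<open>y\<close> the two functions differ by a constant and by \<open>min c I - I\<close>, where \<open>I = min_gap y\<close> and
  \<open>c = min_gap x y\<close>. As \<open>I\<close> decreases in \<open>t\<close>, this difference increases.
\<close>

lemma shadow_cdf_increment_antimono:
  assumes "x \<le> y" "a \<le> b"
  shows "shadow_cdf y b - shadow_cdf y a \<le> shadow_cdf x b - shadow_cdf x a"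
proof (cases "b \<le> y")
  case True
  then show ?thesis using assms shadow_cdf_mono[of a b x] by (simp add: shadow_cdf_eq_0)
next
  case False
  define m where "m = max y a"
  have m: "y \<le> m" "m \<le> b" "y \<le> b" "a \<le> m" using False assms by (auto simp: m_def)
  have "min_gap y b - min_gap y m \<le> min_gap x b - min_gap x m"
    using min_gap_split[of x y b] min_gap_split[of x y m] min_gap_split[of y m b] assms m
    by (simp add: min_def split: if_splits)
  then have "shadow_cdf y b - shadow_cdf y m \<le> shadow_cdf x b - shadow_cdf x m"
    using m assms by (simp add: shadow_cdf_ge)
  moreover have "shadow_cdf y m = shadow_cdf y a"
    by (simp add: m_def shadow_cdf_max)
  moreover have "shadow_cdf x a \<le> shadow_cdf x m"
    using m by (intro shadow_cdf_mono)
  ultimately show ?thesis by simp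
qed

text \<open>
  Since \<open>gap\<close> is right continuous, just to the right of \<open>a\<close> it stays above any level below
  \<open>gap a\<close>, in particular above any level below \<open>min_gap x a\<close>; so the running minimum cannot jump
  down there.
\<close>

lemma min_gap_right_cont:
  assumes "x \<le> a"
  shows "((\<lambda>t. min_gap x t) \<longlongrightarrow> min_gap x a) (at_right a)"
proof (rule order_tendstoI)
  fix c assume "min_gap x a < c"
  have "min_gap x t < c" if "a < t" for t
    using min_gap_split[of x a t] that assms \<open>min_gap x a < c\<close> by simp
  then show "eventually (\<lambda>t. min_gap x t < c) (at_right a)"
    by (auto simp: eventually_at_right[of a "a + 1"] intro!: exI[of _ "a + 1"])
next
  fix c assume "c < min_gap x a"
  then obtain c' where c': "c < c'" "c' < min_gap x a" using dense by blast
  have "continuous (at_right a) gap"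
    unfolding gap_def by (intro continuous_diff \<mu>.cdf_is_right_cont \<nu>.cdf_is_right_cont)
  then have "(gap \<longlongrightarrow> gap a) (at_right a)"
    by (simp add: continuous_within)
  moreover have "c' < gap a" using c' min_gap_le[of x a a] assms by simp
  ultimately have "eventually (\<lambda>s. c' < gap s) (at_right a)"
    by (rule order_tendstoD)
  then obtain b where b: "a < b" "\<And>s. a < s \<Longrightarrow> s < b \<Longrightarrow> c' < gap s"
    by (auto simp: eventually_at_right[of a "a + 1"])
  have "c < min_gap x t" if "a < t" "t < b" for t
  proof -
    have "c' \<le> min_gap a t"
    proof (rule min_gap_greatest)
      fix s assume "a \<le> s" "s \<le> t"
      then show "c' \<le> gap s"
        using b(2)[of s] that \<open>c' < gap a\<close> by (cases "s = a") auto
    qed (use that in simp)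
    then show ?thesis using min_gap_split[of x a t] that assms c' by simp
  qed
  then show "eventually (\<lambda>t. c < min_gap x t) (at_right a)"
    using b(1) by (auto simp: eventually_at_right[of a "a + 1"])
qed

lemma shadow_cdf_right_cont: "continuous (at_right a) (shadow_cdf x)"
proof (cases "x \<le> a")
  case True
  have "((\<lambda>t. cdf \<nu> t - cdf \<mu> x + min_gap x t) \<longlongrightarrow> cdf \<nu> a - cdf \<mu> x + min_gap x a) (at_right a)"
    using \<nu>.cdf_is_right_cont[of a] min_gap_right_cont[OF True]
    by (intro tendsto_intros) (auto simp: continuous_within)
  moreover have "eventually (\<lambda>t. cdf \<nu> t - cdf \<mu> x + min_gap x t = shadow_cdf x t) (at_right a)"
    using True by (auto simp: eventually_at_right[of a "a + 1"] shadow_cdf_ge intro!: exI[of _ "a + 1"])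
  ultimately show ?thesis
    using True by (simp add: continuous_within shadow_cdf_ge tendsto_cong)
next
  case False
  have "eventually (\<lambda>t. 0 = shadow_cdf x t) (at_right a)"
    using False by (auto simp: eventually_at_right[of a "x"] shadow_cdf_eq_0 intro!: exI[of _ "x"])
  then have "(shadow_cdf x \<longlongrightarrow> 0) (at_right a)"
    using tendsto_cong[of "\<lambda>_. 0" "shadow_cdf x"] by auto
  then show ?thesis
    using False by (simp add: continuous_within shadow_cdf_eq_0)
qed

lemma shadow_cdf_at_bot: "(shadow_cdf x \<longlongrightarrow> 0) at_bot"
proof -
  have "eventually (\<lambda>t. 0 = shadow_cdf x t) at_bot"
    using eventually_le_at_bot[of x] by eventually_elim (simp add: shadow_cdf_eq_0)
  then show ?thesis
    using tendsto_cong[of "\<lambda>_. 0" "shadow_cdf x"] by auto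
qed

lemma shadow_cdf_at_top: "(shadow_cdf x \<longlongrightarrow> 1 - cdf \<mu> x) at_top"
proof -
  have "(gap \<longlongrightarrow> 1 - 1) at_top"
    unfolding gap_def by (intro tendsto_diff \<mu>.cdf_lim_at_top_prob \<nu>.cdf_lim_at_top_prob)
  then have gap: "(gap \<longlongrightarrow> 0) at_top" by simp
  have "(min_gap x \<longlongrightarrow> 0) at_top"
  proof (rule tendsto_sandwich[OF _ _ tendsto_const gap])
    show "eventually (\<lambda>t. 0 \<le> min_gap x t) at_top"
      using eventually_ge_at_top[of x] by eventually_elim (rule min_gap_nonneg)
    show "eventually (\<lambda>t. min_gap x t \<le> gap t) at_top"
      using eventually_ge_at_top[of x] by eventually_elim (simp add: min_gap_le)
  qed
  then have "((\<lambda>t. cdf \<nu> t - cdf \<mu> x + min_gap x t) \<longlongrightarrow> 1 - cdf \<mu> x + 0) at_top"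
    by (intro tendsto_intros \<nu>.cdf_lim_at_top_prob)
  moreover have "eventually (\<lambda>t. cdf \<nu> t - cdf \<mu> x + min_gap x t = shadow_cdf x t) at_top"
    using eventually_ge_at_top[of x] by eventually_elim (simp add: shadow_cdf_ge)
  ultimately show ?thesis by (simp add: tendsto_cong)
qed

section \<open>The least element of the set of admissible targets\<close>

text \<open>
  This is the least element of \<^term>\<open>S_set \<mu> \<nu> x\<close>, in the terminology of optimal transport a
  shadow of the restriction of \<open>\<mu>\<close> to \<open>(x, \<infinity>)\<close> in \<open>\<nu>\<close>.
\<close>

definition shadow :: "real \<Rightarrow> real measure" where
  "shadow x = interval_measure (shadow_cdf x)"

lemma sets_shadow [simp]: "sets (shadow x) = sets borel"
  by (simp add: shadow_def)

lemma cdf_shadow: "cdf (shadow x) = shadow_cdf x"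
  unfolding shadow_def
  by (rule cdf_interval_measure[OF shadow_cdf_mono shadow_cdf_right_cont shadow_cdf_at_bot])

lemma emeasure_shadow_UNIV: "emeasure (shadow x) UNIV = ennreal (1 - cdf \<mu> x)"
  unfolding shadow_def
  by (rule interval_measure_UNIV[OF shadow_cdf_mono shadow_cdf_right_cont shadow_cdf_at_bot
        shadow_cdf_at_top]) (simp_all add: \<mu>.cdf_bounded_prob)

lemma finite_borel_measure_shadow: "finite_borel_measure (shadow x)"
  unfolding shadow_def
  by (rule finite_borel_measure_interval_measure[OF shadow_cdf_mono shadow_cdf_right_cont
        shadow_cdf_at_bot shadow_cdf_at_top]) (simp_all add: \<mu>.cdf_bounded_prob)

lemma measure_shadow_UNIV: "measure (shadow x) UNIV = 1 - cdf \<mu> x"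
  using \<mu>.cdf_bounded_prob[of x] by (simp add: measure_def emeasure_shadow_UNIV)

lemma shadow_le: "shadow x \<le> \<nu>"
  by (rule le_measure_if_cdf_increments_le)
    (simp_all add: finite_borel_measure_shadow \<nu>.finite_borel_measure_M cdf_shadow
      shadow_cdf_increment_le)

lemma shadow_antimono: "x \<le> y \<Longrightarrow> shadow y \<le> shadow x"
  by (rule le_measure_if_cdf_increments_le)
    (simp_all add: finite_borel_measure_shadow cdf_shadow shadow_cdf_increment_antimono)

lemma subprob_space_shadow: "subprob_space (shadow x)"
proof
  have "space (shadow x) = UNIV" by (simp add: shadow_def)
  then show "emeasure (shadow x) (space (shadow x)) \<le> 1" "space (shadow x) \<noteq> {}"
    by (simp_all add: emeasure_shadow_UNIV \<mu>.cdf_nonneg)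
qed

lemma shadow_in_S_set: "shadow x \<in> S_set \<mu> \<nu> x"
proof -
  have "restr_meas \<mu> {x<..} \<preceq>\<^sub>s\<^sub>t shadow x"
    unfolding st_le_def
  proof (intro conjI allI)
    fix t
    show "cdf (shadow x) t \<le> cdf (restr_meas \<mu> {x<..}) t"
      using min_gap_le[of x "max x t" "max x t"]
      by (simp add: cdf_shadow \<mu>.restr_meas_greaterThan shadow_cdf_def gap_def)
  qed (simp add: measure_shadow_UNIV \<mu>.restr_meas_greaterThan)
  then show ?thesis
    by (simp add: S_set_def subprob_space_shadow shadow_le)
qed

lemma S_setD:
  assumes "\<theta> \<in> S_set \<mu> \<nu> x"
  shows "finite_borel_measure \<theta>" and "measure \<theta> UNIV = 1 - cdf \<mu> x"
    and "cdf \<theta> t \<le> cdf \<mu> (max x t) - cdf \<mu> x" and "\<theta> \<le> \<nu>"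
proof -
  have "subprob_space \<theta>" "sets \<theta> = sets borel"
    using assms by (simp_all add: S_set_def)
  then show "finite_borel_measure \<theta>"
    by (simp add: finite_borel_measure_def finite_borel_measure_axioms_def
        subprob_space_def)
  show "measure \<theta> UNIV = 1 - cdf \<mu> x" "cdf \<theta> t \<le> cdf \<mu> (max x t) - cdf \<mu> x" "\<theta> \<le> \<nu>"
    using assms by (simp_all add: S_set_def st_le_def \<mu>.restr_meas_greaterThan)
qed

text \<open>
  Splitting at \<open>s\<close>: below \<open>s\<close> the mass of \<open>\<theta>\<close> is bounded by the stochastic order, above \<open>s\<close> by
  \<open>\<theta> \<le> \<nu>\<close>. The minimum over \<open>s\<close> of the resulting bounds is \<^term>\<open>shadow_cdf x\<close>.
\<close>

lemma cdf_le_shadow_cdf: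
  assumes "\<theta> \<in> S_set \<mu> \<nu> x"
  shows "cdf \<theta> t \<le> shadow_cdf x t"
proof -
  note \<theta> = S_setD[OF assms]
  define m where "m = max x t"
  have "x \<le> m" by (simp add: m_def)
  have "cdf \<theta> m - cdf \<nu> m + cdf \<mu> x \<le> min_gap x m"
  proof (rule min_gap_greatest[OF \<open>x \<le> m\<close>])
    fix s assume s: "x \<le> s" "s \<le> m"
    have "cdf \<theta> m - cdf \<theta> s \<le> cdf \<nu> m - cdf \<nu> s"
      using \<theta>(1) \<nu>.finite_borel_measure_M \<theta>(4) s(2) by (rule increments_le_if_le_measure)
    moreover have "cdf \<theta> s \<le> cdf \<mu> s - cdf \<mu> x"
      using \<theta>(3)[of s] s(1) by (simp add: max_def)
    ultimately show "cdf \<theta> m - cdf \<nu> m + cdf \<mu> x \<le> gap s"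
      by (simp add: gap_def)
  qed
  moreover have "cdf \<theta> t \<le> cdf \<theta> m"
    by (rule finite_borel_measure.cdf_nondecreasing[OF \<theta>(1)]) (simp add: m_def)
  ultimately show ?thesis by (simp add: shadow_cdf_def m_def)
qed

lemma shadow_least: "\<theta> \<in> S_set \<mu> \<nu> x \<Longrightarrow> shadow x \<preceq>\<^sub>s\<^sub>t \<theta>"
  by (simp add: st_le_def S_setD(2) measure_shadow_UNIV cdf_shadow cdf_le_shadow_cdf)

text \<open>
  The supremum of the distribution functions is a maximum, attained at every \<open>t\<close> by the same measure.
\<close>

lemma nu_meas_eq_shadow: "nu_meas \<mu> \<nu> x = shadow x"
proof -
  have sup: "(SUP \<theta>\<in>S_set \<mu> \<nu> x. cdf \<theta> t) = cdf (shadow x) t" for t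
  proof (rule cSup_eq_maximum)
    show "cdf (shadow x) t \<in> (\<lambda>\<theta>. cdf \<theta> t) ` S_set \<mu> \<nu> x"
      using shadow_in_S_set by blast
  qed (auto simp: cdf_shadow cdf_le_shadow_cdf)
  show ?thesis
    unfolding nu_meas_def sup
  proof (rule the_equality)
    fix \<eta> assume \<eta>: "sets \<eta> = sets borel \<and> subprob_space \<eta> \<and> (\<forall>t. cdf \<eta> t = cdf (shadow x) t)"
    then have "finite_borel_measure \<eta>"
      by (simp add: finite_borel_measure_def finite_borel_measure_axioms_def subprob_space_def)
    then show "\<eta> = shadow x"
      using \<eta> by (intro cdf_unique' finite_borel_measure_shadow) auto
  qed (simp add: subprob_space_shadow)
qed

end

section \<open>A coupling from a decreasing family of submeasures\<close>

text \<open>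
  Otherwise \<open>g < f\<close> on a set that is not null, and on that set \<open>f\<close> has the larger integral, strictly
  so because the integral of \<open>g\<close> is finite.
\<close>

lemma AE_le_if_density_le:
  fixes f g :: "'a \<Rightarrow> ennreal"
  assumes [measurable]: "f \<in> borel_measurable M" "g \<in> borel_measurable M"
    and le: "\<And>A. A \<in> sets M \<Longrightarrow> emeasure (density M f) A \<le> emeasure (density M g) A"
    and fin: "(\<integral>\<^sup>+x. g x \<partial>M) \<noteq> \<infinity>"
  shows "AE x in M. f x \<le> g x"
proof (rule ccontr)
  assume neg: "\<not> (AE x in M. f x \<le> g x)"
  define A where "A = {x\<in>space M. g x < f x}"
  have A[measurable]: "A \<in> sets M" unfolding A_def by measurable
  have "(\<integral>\<^sup>+x. g x * indicator A x \<partial>M) < (\<integral>\<^sup>+x. f x * indicator A x \<partial>M)"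
  proof (rule nn_integral_less)
    have "(\<integral>\<^sup>+x. g x * indicator A x \<partial>M) \<le> (\<integral>\<^sup>+x. g x \<partial>M)"
      by (intro nn_integral_mono) (simp add: indicator_def)
    then show "(\<integral>\<^sup>+x. g x * indicator A x \<partial>M) \<noteq> \<infinity>"
      using fin by (auto simp: top_unique)
    show "AE x in M. g x * indicator A x \<le> f x * indicator A x"
      by (rule AE_I2) (auto simp: A_def indicator_def)
    show "\<not> (AE x in M. f x * indicator A x \<le> g x * indicator A x)"
    proof
      assume "AE x in M. f x * indicator A x \<le> g x * indicator A x"
      then have "AE x in M. f x \<le> g x"
        using AE_space
      proof eventually_elim
        case (elim x)
        then show ?case by (cases "x \<in> A") (auto simp: A_def)
      qed
      then show False using neg by simp
    qed
  qed measurable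
  then show False
    using le[OF A] by (simp add: emeasure_density)
qed

text \<open>
  This turns a density bounded by \<open>1\<close> into the conditional probability of an event.
\<close>

lemma emeasure_uniform_below:
  assumes "c \<le> 1"
  shows "emeasure (uniform_measure lborel {0..1::real}) {v. ennreal v < c} = c"
proof -
  obtain r where r: "c = ennreal r" "0 \<le> r"
    using assms by (cases c) (simp_all add: top_unique)
  then have "r \<le> 1"
    using assms by simp
  have eq: "{0..1} \<inter> {v. ennreal v < c} = {0..<r}"
    using \<open>r \<le> 1\<close> by (auto simp: r(1) ennreal_less_iff)
  have "emeasure (uniform_measure lborel {0..1::real}) {v. ennreal v < c}
      = emeasure lborel ({0..1} \<inter> {v. ennreal v < c}) / emeasure lborel {0..1::real}"
    by (rule emeasure_uniform_measure) simp_all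
  then show ?thesis
    unfolding eq using r by (simp add: divide_ennreal_def)
qed

text \<open>
  Let \<open>f x\<close> be a density of \<open>K x\<close> with respect to \<open>\<nu>\<close>. On the product of \<open>\<nu>\<close> and the uniform
  distribution the event \<open>T x\<close>, that the uniform variable \<open>v\<close> lies below \<open>f x y\<close>, restricted to
  \<open>y \<in> B\<close> has probability \<open>K x B\<close>. The events \<open>T x\<close> decrease in \<open>x\<close>, up to null sets, and the point
  \<open>X\<close> where they cease to hold has the required tails. Each density is determined only up to a null
  set, so \<open>X\<close> is computed from rational indices alone, and the tail at \<open>x\<close> is recovered from
  rationals \<open>q > x\<close> by right continuity of the distribution function of \<open>\<mu>\<close>.
\<close>

lemma ex_coupling_of_antimono_family:
  fixes \<mu> \<nu> :: "real measure" and K :: "real \<Rightarrow> real measure"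
  assumes "real_distribution \<mu>" and "real_distribution \<nu>"
    and sets_K: "\<And>x. sets (K x) = sets borel"
    and K_le: "\<And>x. K x \<le> \<nu>"
    and K_antimono: "\<And>x y. x \<le> y \<Longrightarrow> K y \<le> K x"
    and K_mass: "\<And>x. emeasure (K x) UNIV = emeasure \<mu> {x<..}"
  shows "\<exists>P. coupling \<mu> \<nu> P \<and>
    (\<forall>x. \<forall>B\<in>sets borel. emeasure P ({x<..} \<times> B) = emeasure (K x) B)"
proof -
  interpret \<mu>: real_distribution \<mu> by fact
  interpret \<nu>: real_distribution \<nu> by fact
  have K_le_set: "emeasure (K x) B \<le> emeasure \<nu> B" for x B
    using K_le by (rule le_measureD3) (simp add: sets_K)
  have K_antimono_set: "emeasure (K y) B \<le> emeasure (K x) B" if "x \<le> y" for x y B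
    using K_antimono[OF that] by (rule le_measureD3) (simp add: sets_K)
  define f where "f x = RN_deriv \<nu> (K x)" for x
  have f_meas[measurable]: "f x \<in> borel_measurable borel" for x
    using borel_measurable_RN_deriv[of \<nu> "K x"]
    unfolding f_def measurable_cong_sets[OF \<nu>.events_eq_borel refl] .
  have density_f: "density \<nu> (f x) = K x" for x
    unfolding f_def
  proof (rule \<nu>.density_RN_deriv)
    show "absolutely_continuous \<nu> (K x)"
      unfolding absolutely_continuous_def
    proof
      fix A assume "A \<in> null_sets \<nu>"
      then show "A \<in> null_sets (K x)"
        using K_le_set[of x A] by (simp add: null_sets_def sets_K)
    qed
  qed (simp add: sets_K)
  have f_int: "(\<integral>\<^sup>+y. f x y \<partial>\<nu>) \<noteq> \<infinity>" for x
  proof -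
    have "(\<integral>\<^sup>+y. f x y \<partial>\<nu>) = emeasure (density \<nu> (f x)) (space \<nu>)"
      by (subst emeasure_density) simp_all
    then show ?thesis
      using K_mass[of x] \<mu>.emeasure_finite[of "{x<..}"] by (simp add: density_f)
  qed
  have f_le_1: "AE y in \<nu>. f x y \<le> 1" for x
  proof (rule AE_le_if_density_le)
    show "emeasure (density \<nu> (f x)) A \<le> emeasure (density \<nu> (\<lambda>_. 1)) A" for A
      by (simp only: density_f density_1 K_le_set)
    show "(\<integral>\<^sup>+y. 1 \<partial>\<nu>) \<noteq> \<infinity>"
      using \<nu>.emeasure_space_1 by simp
  qed simp_all
  have f_antimono: "AE y in \<nu>. f z y \<le> f x y" if "x \<le> z" for x z
  proof (rule AE_le_if_density_le)
    show "emeasure (density \<nu> (f z)) A \<le> emeasure (density \<nu> (f x)) A" for A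
      unfolding density_f by (rule K_antimono_set[OF that])
  qed (use f_int[of x] in simp_all)
  define U where "U = uniform_measure lborel {0..1::real}"
  interpret U: prob_space U
    unfolding U_def by (rule prob_space_uniform_measure) simp_all
  have sets_U[measurable_cong]: "sets U = sets borel" by (simp add: U_def)
  have space_U: "space U = UNIV" by (simp add: U_def)
  define Q where "Q = \<nu> \<Otimes>\<^sub>M U"
  interpret NU: pair_prob_space \<nu> U ..
  interpret Q: prob_space Q unfolding Q_def by (rule NU.P.prob_space_axioms)
  have sets_Q[measurable_cong]: "sets Q = sets (borel \<Otimes>\<^sub>M borel)"
    unfolding Q_def by (intro sets_pair_measure_cong) (simp_all add: sets_U)
  have space_Q: "space Q = UNIV" by (simp add: Q_def space_pair_measure space_U)
  have AE_fst: "AE p in Q. R (fst p)" if "AE y in \<nu>. R y" for R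
  proof -
    have "AE y in distr Q \<nu> fst. R y"
      unfolding Q_def U.distr_pair_fst by fact
    then show ?thesis
      by (rule AE_distrD[rotated]) (simp add: Q_def)
  qed
  define T where "T x = {p :: real \<times> real. ennreal (snd p) < f x (fst p)}" for x
  have T_meas[measurable]: "T x \<in> sets (borel \<Otimes>\<^sub>M borel)" for x
  proof -
    have "Measurable.pred (borel \<Otimes>\<^sub>M borel) (\<lambda>p::real\<times>real. ennreal (snd p) < f x (fst p))"
      by measurable
    then show ?thesis by (simp add: T_def pred_def space_pair_measure)
  qed
  have Q_T: "emeasure Q {p \<in> T x. fst p \<in> B} = emeasure (K x) B" if [measurable]: "B \<in> sets borel" for x B
  proof -
    have "emeasure Q {p \<in> T x. fst p \<in> B}
        = (\<integral>\<^sup>+y. emeasure U (Pair y -` {p \<in> T x. fst p \<in> B}) \<partial>\<nu>)"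
      unfolding Q_def
    proof (rule U.emeasure_pair_measure_alt)
      have "{p \<in> T x. fst p \<in> B} = T x \<inter> (B \<times> UNIV)" by auto
      also have "\<dots> \<in> sets Q" by (simp add: sets_Q)
      finally show "{p \<in> T x. fst p \<in> B} \<in> sets (\<nu> \<Otimes>\<^sub>M U)" by (simp add: Q_def)
    qed
    also have "\<dots> = (\<integral>\<^sup>+y. f x y * indicator B y \<partial>\<nu>)"
    proof (rule nn_integral_cong_AE)
      show "AE y in \<nu>. emeasure U (Pair y -` {p \<in> T x. fst p \<in> B}) = f x y * indicator B y"
        using f_le_1[of x]
      proof eventually_elim
        case (elim y)
        have "Pair y -` {p \<in> T x. fst p \<in> B} = (if y \<in> B then {v. ennreal v < f x y} else {})"
          by (auto simp: T_def)
        with elim show ?case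
          using emeasure_uniform_below[of "f x y"] unfolding U_def by (simp del: emeasure_uniform_measure)
      qed
    qed
    also have "\<dots> = emeasure (density \<nu> (f x)) B"
      by (simp add: emeasure_density)
    finally show ?thesis by (simp add: density_f)
  qed
  \<comment> \<open>The value \<open>- \<infinity>\<close> keeps indices outside the event from contributing to the supremum; \<open>X\<close> is
    extended-real valued because the events \<open>T q\<close> may hold for all \<open>q\<close>, or for none, on a null set.\<close>
  define X where "X p = (SUP q\<in>\<rat>. if p \<in> T q then ereal q else - \<infinity>)" for p
  have less_X: "ereal x < X p \<longleftrightarrow> (\<exists>q\<in>\<rat>. x < q \<and> p \<in> T q)" for x p
    unfolding X_def less_SUP_iff by (intro bex_cong) auto
  have X_meas[measurable]: "X \<in> borel_measurable (borel \<Otimes>\<^sub>M borel)"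
    unfolding X_def
  proof (rule borel_measurable_SUP[OF countable_rat])
    fix q
    show "(\<lambda>p. if p \<in> T q then ereal q else - \<infinity>) \<in> borel_measurable (borel \<Otimes>\<^sub>M borel)"
      by (intro measurable_If_set measurable_const) (auto simp: space_pair_measure T_meas)
  qed
  have X_meas_Q[measurable]: "X \<in> borel_measurable Q"
    using X_meas unfolding measurable_cong_sets[OF sets_Q refl] .
  have tail_sets[measurable]: "{p. ereal x < X p \<and> fst p \<in> B} \<in> sets Q" if [measurable]: "B \<in> sets borel" for x B
  proof -
    have "Measurable.pred (borel \<Otimes>\<^sub>M borel) (\<lambda>p. ereal x < X p \<and> fst p \<in> B)"
      by measurable
    then show ?thesis by (simp add: pred_def space_pair_measure sets_Q)
  qed
  \<comment> \<open>One inequality holds setwise by monotonicity, the reverse one for the total mass by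
    right continuity. Together they give equality on every set.\<close>
  have tail_le: "emeasure Q {p. ereal x < X p \<and> fst p \<in> B} \<le> emeasure (K x) B"
    if [measurable]: "B \<in> sets borel" for x B
  proof -
    have "AE y in \<nu>. \<forall>q\<in>\<rat>. x < q \<longrightarrow> f q y \<le> f x y"
      using f_antimono[of x] by (subst AE_ball_countable[OF countable_rat]) auto
    then have "AE p in Q. \<forall>q\<in>\<rat>. x < q \<longrightarrow> f q (fst p) \<le> f x (fst p)"
      by (rule AE_fst)
    then have "AE p in Q. ereal x < X p \<and> fst p \<in> B \<longrightarrow> p \<in> T x \<and> fst p \<in> B"
    proof eventually_elim
      case (elim p)
      show ?case
      proof
        assume p: "ereal x < X p \<and> fst p \<in> B"
        then obtain q where "q \<in> \<rat>" "x < q" "p \<in> T q"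
          unfolding less_X by blast
        then have "ennreal (snd p) < f q (fst p)" "f q (fst p) \<le> f x (fst p)"
          using elim by (simp_all add: T_def)
        then show "p \<in> T x \<and> fst p \<in> B"
          using p by (simp add: T_def)
      qed
    qed
    then have "emeasure Q {p. ereal x < X p \<and> fst p \<in> B} \<le> emeasure Q {p \<in> T x. fst p \<in> B}"
    proof (intro emeasure_mono_AE)
      have "{p \<in> T x. fst p \<in> B} = T x \<inter> (B \<times> UNIV)" by auto
      then show "{p \<in> T x. fst p \<in> B} \<in> sets Q" by (simp add: sets_Q)
    qed auto
    then show ?thesis by (simp add: Q_T)
  qed
  have mass_K: "emeasure (K x) UNIV = ennreal (1 - cdf \<mu> x)" for x
    by (simp add: K_mass \<mu>.emeasure_eq_measure \<mu>.measure_greaterThan)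
  \<comment> \<open>If this failed at \<open>x\<close>, it would still fail at some rational \<open>q > x\<close>, although the event \<open>T q\<close>
    has probability \<open>1 - cdf \<mu> q\<close> and implies \<open>x < X\<close>.\<close>
  have Q_tail_ge: "1 - cdf \<mu> x \<le> measure Q {p. ereal x < X p}" for x
  proof (rule ccontr)
    assume "\<not> 1 - cdf \<mu> x \<le> measure Q {p. ereal x < X p}"
    then have "cdf \<mu> x < 1 - measure Q {p. ereal x < X p}" by simp
    moreover have "(cdf \<mu> \<longlongrightarrow> cdf \<mu> x) (at_right x)"
      using \<mu>.cdf_is_right_cont[of x] by (simp add: continuous_within)
    ultimately have "eventually (\<lambda>q. cdf \<mu> q < 1 - measure Q {p. ereal x < X p}) (at_right x)"
      by (simp add: order_tendstoD)
    then obtain b where b: "x < b"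
      "\<And>q. x < q \<Longrightarrow> q < b \<Longrightarrow> cdf \<mu> q < 1 - measure Q {p. ereal x < X p}"
      by (auto simp: eventually_at_right[of x "x + 1"])
    obtain q where q: "q \<in> \<rat>" "x < q" "q < b"
      using Rats_dense_in_real[OF b(1)] by auto
    have "T q \<subseteq> {p. ereal x < X p}" using q by (auto simp: less_X)
    then have mono: "emeasure Q {p \<in> T q. fst p \<in> UNIV} \<le> emeasure Q {p. ereal x < X p}"
      using tail_sets[of UNIV x] by (intro emeasure_mono) auto
    have eq: "emeasure Q {p \<in> T q. fst p \<in> UNIV} = ennreal (1 - cdf \<mu> q)"
      unfolding mass_K[symmetric] by (rule Q_T) simp
    have "1 - cdf \<mu> q \<le> measure Q {p. ereal x < X p}"
      using mono unfolding eq by (simp add: Q.emeasure_eq_measure ennreal_le_iff)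
    with b(2)[OF q(2,3)] show False by simp
  qed
  have tail: "emeasure Q {p. ereal x < X p \<and> fst p \<in> B} = emeasure (K x) B"
    if B[measurable]: "B \<in> sets borel" for x B
  proof -
    interpret Kx: finite_measure "K x"
      by (rule finite_measureI)
        (use K_mass[of x] sets_eq_imp_space_eq[OF sets_K[of x]] in simp)
    have le: "measure Q {p. ereal x < X p \<and> fst p \<in> C} \<le> measure (K x) C" if "C \<in> sets borel" for C
      using tail_le[OF that, of x]
      by (simp add: Q.emeasure_eq_measure Kx.emeasure_eq_measure ennreal_le_iff)
    have "measure Q {p. ereal x < X p}
        = measure Q ({p. ereal x < X p \<and> fst p \<in> B} \<union> {p. ereal x < X p \<and> fst p \<in> - B})"
      by (rule arg_cong[where f = "measure Q"]) blast
    also have "\<dots>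
        = measure Q {p. ereal x < X p \<and> fst p \<in> B} + measure Q {p. ereal x < X p \<and> fst p \<in> - B}"
      using B by (intro Q.finite_measure_Union tail_sets) auto
    finally have split_Q: "measure Q {p. ereal x < X p}
        = measure Q {p. ereal x < X p \<and> fst p \<in> B} + measure Q {p. ereal x < X p \<and> fst p \<in> - B}" .
    have "measure (K x) (B \<union> - B) = measure (K x) B + measure (K x) (- B)"
      using B by (intro Kx.finite_measure_Union) (simp_all add: sets_K)
    then have split_K: "measure (K x) UNIV = measure (K x) B + measure (K x) (- B)"
      by (simp add: Compl_partition)
    have "measure (K x) UNIV = 1 - cdf \<mu> x"
      using \<mu>.cdf_bounded_prob[of x] by (simp add: measure_def mass_K)
    moreover have "measure Q {p. ereal x < X p \<and> fst p \<in> - B} \<le> measure (K x) (- B)"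
      using B by (intro le) simp
    ultimately have "measure Q {p. ereal x < X p \<and> fst p \<in> B} = measure (K x) B"
      using le[OF B] split_Q split_K Q_tail_ge[of x] by linarith
    then show ?thesis
      by (simp add: Q.emeasure_eq_measure Kx.emeasure_eq_measure)
  qed
  have Q_tail: "measure Q {p. ereal x < X p} = 1 - cdf \<mu> x" for x
    using tail[of UNIV x] \<mu>.cdf_bounded_prob[of x]
    by (simp add: measure_def mass_K)
  \<comment> \<open>The tails of \<open>X\<close> are those of the probability measure \<open>\<mu>\<close>, so no mass sits at \<open>\<plusminus>\<infinity>\<close>.\<close>
  have X_finite: "AE p in Q. \<bar>X p\<bar> \<noteq> \<infinity>"
  proof -
    have "measure Q {p. X p = \<infinity>} \<le> 0"
    proof (rule LIMSEQ_le_const)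
      show "(\<lambda>n. 1 - cdf \<mu> (real n)) \<longlonglongrightarrow> 0"
        using tendsto_diff[OF tendsto_const \<mu>.cdf_lim_infty_prob, of 1] by simp
      have "measure Q {p. X p = \<infinity>} \<le> 1 - cdf \<mu> (real n)" for n
        unfolding Q_tail[symmetric] using tail_sets[of UNIV "real n"]
        by (intro Q.finite_measure_mono) auto
      then show "\<exists>N. \<forall>n\<ge>N. measure Q {p. X p = \<infinity>} \<le> 1 - cdf \<mu> (real n)" by blast
    qed
    moreover have "measure Q {p. X p = - \<infinity>} \<le> 0"
    proof (rule LIMSEQ_le_const[OF \<mu>.cdf_lim_neg_infty])
      have "measure Q {p. X p = - \<infinity>} \<le> cdf \<mu> (- real n)" for n
      proof -
        have "measure Q {p. X p = - \<infinity>} \<le> measure Q (space Q - {p. ereal (- real n) < X p})"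
          using sets.compl_sets[OF tail_sets[of UNIV "- real n"]]
          by (intro Q.finite_measure_mono) (auto simp: space_Q)
        also have "\<dots> = 1 - measure Q {p. ereal (- real n) < X p}"
          using tail_sets[of UNIV "- real n"] by (intro Q.prob_compl) simp
        finally show ?thesis by (simp only: Q_tail)
      qed
      then show "\<exists>N. \<forall>n\<ge>N. measure Q {p. X p = - \<infinity>} \<le> cdf \<mu> (- real n)" by blast
    qed
    ultimately have "measure Q {p. X p = \<infinity>} = 0" "measure Q {p. X p = - \<infinity>} = 0"
      by (auto intro: order.antisym)
    moreover have "{p. X p = c} \<in> sets Q" for c
      using measurable_sets[OF X_meas_Q, of "{c}"] by (simp add: space_Q vimage_def)
    ultimately have "{p. X p = \<infinity>} \<in> null_sets Q" "{p. X p = - \<infinity>} \<in> null_sets Q"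
      by (simp_all add: null_sets_def Q.emeasure_eq_measure)
    from this[THEN AE_not_in] have "AE p in Q. X p \<noteq> \<infinity>" "AE p in Q. X p \<noteq> - \<infinity>"
      by simp_all
    then show ?thesis by eventually_elim auto
  qed
  define P where "P = distr Q borel (\<lambda>p. (real_of_ereal (X p), fst p))"
  have pair_meas[measurable]: "(\<lambda>p. (real_of_ereal (X p), fst p)) \<in> Q \<rightarrow>\<^sub>M borel"
    unfolding borel_prod[symmetric] by measurable
  have P_tail: "emeasure P ({x<..} \<times> B) = emeasure (K x) B" if [measurable]: "B \<in> sets borel" for x B
  proof -
    have "emeasure P ({x<..} \<times> B) = emeasure Q {p. x < real_of_ereal (X p) \<and> fst p \<in> B}"
    proof -
      have "{x<..} \<times> B \<in> sets borel"
        unfolding borel_prod[symmetric] by measurable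
      then show ?thesis
        unfolding P_def by (subst emeasure_distr) (auto simp: space_Q intro!: arg_cong[where f = "emeasure Q"])
    qed
    also have "\<dots> = emeasure Q {p. ereal x < X p \<and> fst p \<in> B}"
    proof (rule emeasure_eq_AE)
      show "AE p in Q. p \<in> {p. x < real_of_ereal (X p) \<and> fst p \<in> B} \<longleftrightarrow>
          p \<in> {p. ereal x < X p \<and> fst p \<in> B}"
        using X_finite
      proof eventually_elim
        case (elim p)
        then show ?case by (cases "X p") auto
      qed
      have "Measurable.pred Q (\<lambda>p. x < real_of_ereal (X p) \<and> fst p \<in> B)" by measurable
      then show "{p. x < real_of_ereal (X p) \<and> fst p \<in> B} \<in> sets Q"
        by (simp add: pred_def space_Q)
    qed measurable
    finally show ?thesis by (simp add: tail)
  qed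
  have prob_P: "prob_space P"
    unfolding P_def by (rule Q.prob_space_distr) measurable
  have sets_P: "sets P = sets borel"
    by (simp add: P_def)
  have proj_meas: "fst \<in> (borel :: (real \<times> real) measure) \<rightarrow>\<^sub>M borel"
    "snd \<in> (borel :: (real \<times> real) measure) \<rightarrow>\<^sub>M borel"
    by (intro borel_measurable_continuous_onI continuous_intros)+
  have "distr P borel snd = distr Q borel (snd \<circ> (\<lambda>p. (real_of_ereal (X p), fst p)))"
    unfolding P_def by (rule distr_distr[OF proj_meas(2) pair_meas])
  also have "\<dots> = distr Q \<nu> fst"
    by (rule distr_cong) simp_all
  also have "\<dots> = \<nu>"
    unfolding Q_def by (rule U.distr_pair_fst)
  finally have snd_P: "distr P borel snd = \<nu>" .
  have fst_P: "distr P borel fst = \<mu>"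
  proof (rule cdf_unique)
    have fst_meas: "fst \<in> P \<rightarrow>\<^sub>M borel"
      using proj_meas(1) unfolding measurable_cong_sets[OF sets_P refl] .
    then show D: "real_distribution (distr P borel fst)"
      by (rule prob_space.real_distribution_distr[OF prob_P])
    show "cdf (distr P borel fst) = cdf \<mu>"
    proof
      fix t
      have "space P = UNIV"
        using sets_eq_imp_space_eq[OF sets_P] by simp
      then have "fst -` {t<..} \<inter> space P = {t<..} \<times> UNIV"
        by auto
      then have "emeasure (distr P borel fst) {t<..} = ennreal (1 - cdf \<mu> t)"
        using P_tail[of UNIV t] by (simp add: emeasure_distr[OF fst_meas] mass_K)
      then have "1 - cdf \<mu> t = measure (distr P borel fst) {t<..}"
        using \<mu>.cdf_bounded_prob[of t] by (simp add: measure_def)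
      also have "\<dots> = 1 - cdf (distr P borel fst) t"
        by (rule real_distribution.measure_greaterThan[OF D])
      finally show "cdf (distr P borel fst) t = cdf \<mu> t" by simp
    qed
  qed fact
  have "coupling \<mu> \<nu> P"
    unfolding coupling_def by (intro conjI sets_P prob_P fst_P snd_P)
  then show ?thesis
    using P_tail by blast
qed

section \<open>Uniqueness and directionality\<close>

text \<open>
  The sets \<open>(x, \<infinity>) \<times> B\<close> are stable under intersection and generate the Borel sets of the plane.
\<close>

lemma measure_eq_if_tails_eq:
  fixes P P' :: "(real \<times> real) measure"
  assumes "sets P = sets borel" and "sets P' = sets borel" and "finite_measure P"
    and eq: "\<And>x B. B \<in> sets borel \<Longrightarrow> emeasure P ({x<..} \<times> B) = emeasure P' ({x<..} \<times> B)"
  shows "P = P'"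
proof -
  interpret P: finite_measure P by fact
  let ?E = "{a \<times> b | a b. a \<in> range greaterThan \<and> b \<in> sets (borel :: real measure)} :: (real \<times> real) set set"
  have top: "(\<Union>i::nat. {- real i<..}) = (UNIV :: real set)"
  proof -
    have "\<exists>i::nat. - real i < x" for x
      using reals_Archimedean2[of "- x"] by (auto simp: minus_less_iff)
    then show ?thesis by auto
  qed
  have "sets (borel \<Otimes>\<^sub>M borel :: (real \<times> real) measure) = sets (sigma (UNIV \<times> UNIV) ?E)"
  proof -
    have "sets (borel \<Otimes>\<^sub>M borel :: (real \<times> real) measure)
        = sets (sigma (space (borel::real measure) \<times> space (borel::real measure)) ?E)"
    proof (rule sets_pair_eq)
      show "sets (borel :: real measure) = sigma_sets (space borel) (range greaterThan)"
        by (subst borel_Ioi) simp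
      show "countable (range (\<lambda>i::nat. {- real i<..}))" by simp
      show "\<Union> (range (\<lambda>i::nat. {- real i<..})) = space borel" using top by simp
      show "countable {UNIV :: real set}" by simp
      show "sets (borel :: real measure) = sigma_sets (space borel) (sets borel)"
        using sets.sigma_sets_eq[of "borel :: real measure"] by simp
    qed (use sets.top[of "borel :: real measure"] in \<open>simp_all add: image_subset_iff\<close>)
    then show ?thesis by simp
  qed
  then have gen: "sets (borel :: (real \<times> real) measure) = sigma_sets UNIV ?E"
    unfolding borel_prod by simp
  show ?thesis
  proof (rule measure_eqI_generator_eq[where \<Omega> = UNIV and E = ?E
        and A = "\<lambda>i::nat. {- real i<..} \<times> UNIV"])
    show "Int_stable ?E"
    proof (rule Int_stableI)
      fix S T assume "S \<in> ?E" "T \<in> ?E"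
      then obtain a B b C where "S = {a<..} \<times> B" "T = {b<..} \<times> C" "B \<in> sets borel" "C \<in> sets borel"
        by auto
      then have "S \<inter> T = {max a b<..} \<times> (B \<inter> C)" "B \<inter> C \<in> sets borel" by auto
      then show "S \<inter> T \<in> ?E" by blast
    qed
    show "(\<Union>i::nat. {- real i<..} \<times> UNIV) = (UNIV :: (real \<times> real) set)"
    proof -
      have "(\<Union>i::nat. {- real i<..} \<times> UNIV) = (\<Union>i::nat. {- real i<..}) \<times> (UNIV :: real set)"
        by auto
      then show ?thesis by (simp add: top)
    qed
    show "emeasure P S = emeasure P' S" if S: "S \<in> ?E" for S
    proof -
      obtain x B where "S = {x<..} \<times> B" "B \<in> sets borel"
        using S by blast
      then show ?thesis using eq by simp
    qed
    show "range (\<lambda>i::nat. {- real i<..} \<times> UNIV) \<subseteq> ?E"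
    proof
      fix S :: "(real \<times> real) set"
      assume "S \<in> range (\<lambda>i::nat. {- real i<..} \<times> UNIV)"
      then obtain i :: nat where "S = {- real i<..} \<times> UNIV" by blast
      then show "S \<in> ?E"
        using sets.top[of "borel :: real measure"] unfolding space_borel by blast
    qed
    show "sets P = sigma_sets UNIV ?E" "sets P' = sigma_sets UNIV ?E"
      by (simp_all only: assms(1,2) gen)
  qed (simp_all add: P.emeasure_finite)
qed

text \<open>
  The points with \<open>y < x\<close> are covered by the sets \<open>(q, \<infinity>) \<times> (-\<infinity>, q]\<close> with rational \<open>q\<close>.
\<close>

lemma directional_if_tails_vanish:
  assumes sets: "sets P = sets borel"
    and null: "\<And>x. emeasure P ({x<..} \<times> {..x}) = 0"
  shows "directional P"
  unfolding directional_def
proof -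
  have "AE p in P. p \<notin> {q<..} \<times> {..q}" for q :: real
  proof (rule AE_not_in)
    have "{q<..} \<times> {..q} \<in> sets borel"
      unfolding borel_prod[symmetric] by measurable
    then show "{q<..} \<times> {..q} \<in> null_sets P"
      using null sets by (auto simp: null_sets_def)
  qed
  then have "AE p in P. \<forall>q\<in>\<rat>. p \<notin> {q<..} \<times> {..q}"
    by (subst AE_ball_countable[OF countable_rat]) blast
  then show "AE p in P. p \<in> {(x, y). y \<ge> x}"
  proof eventually_elim
    case (elim p)
    show ?case
    proof (rule ccontr)
      assume "p \<notin> {(x, y). y \<ge> x}"
      then have "snd p < fst p" by (auto simp: case_prod_beta)
      then obtain q where "q \<in> \<rat>" "snd p < q" "q < fst p"
        using Rats_dense_in_real by blast
      then show False using elim by (cases p) auto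
    qed
  qed
qed

theorem theorem2p1:
  fixes \<mu> \<nu> :: "real measure"
  assumes "real_distribution \<mu>" and "real_distribution \<nu>"
    and "\<mu> \<preceq>\<^sub>s\<^sub>t \<nu>"
  shows "(\<exists>!P. coupling \<mu> \<nu> P \<and> directional P \<and>
            (\<forall>x. \<forall>B\<in>sets borel. emeasure P ({x<..} \<times> B) = emeasure (nu_meas \<mu> \<nu> x) B))
       \<and> (\<forall>x. nu_meas \<mu> \<nu> x \<in> S_set \<mu> \<nu> x
            \<and> (\<forall>\<theta>\<in>S_set \<mu> \<nu> x. nu_meas \<mu> \<nu> x \<preceq>\<^sub>s\<^sub>t \<theta>)
            \<and> (\<forall>\<theta>\<in>S_set \<mu> \<nu> x. (\<forall>\<theta>'\<in>S_set \<mu> \<nu> x. \<theta> \<preceq>\<^sub>s\<^sub>t \<theta>') \<longrightarrow> \<theta> = nu_meas \<mu> \<nu> x))"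
proof -
  interpret st_ordered_pair \<mu> \<nu>
    using assms by (simp add: st_ordered_pair_def st_ordered_pair_axioms_def)
  have mass: "emeasure (shadow x) UNIV = emeasure \<mu> {x<..}" for x
    by (simp add: emeasure_shadow_UNIV \<mu>.emeasure_eq_measure \<mu>.measure_greaterThan)
  obtain P where P: "coupling \<mu> \<nu> P"
    "\<And>x B. B \<in> sets borel \<Longrightarrow> emeasure P ({x<..} \<times> B) = emeasure (shadow x) B"
    using ex_coupling_of_antimono_family[OF assms(1,2) sets_shadow shadow_le shadow_antimono mass]
    by blast
  have "emeasure (shadow x) {..x} = 0" for x
    using finite_borel_measure_shadow[of x] cdf_shadow[of x]
    by (simp add: cdf_def fun_eq_iff shadow_cdf_eq_0 finite_borel_measure_def
        finite_measure.emeasure_eq_measure)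
  then have dir: "directional P"
    using P by (intro directional_if_tails_vanish) (auto simp: coupling_def)
  have "\<exists>!P. coupling \<mu> \<nu> P \<and> directional P \<and>
      (\<forall>x. \<forall>B\<in>sets borel. emeasure P ({x<..} \<times> B) = emeasure (shadow x) B)"
  proof (rule ex1I[of _ P])
    fix P' assume P': "coupling \<mu> \<nu> P' \<and> directional P' \<and>
      (\<forall>x. \<forall>B\<in>sets borel. emeasure P' ({x<..} \<times> B) = emeasure (shadow x) B)"
    show "P' = P"
    proof (rule measure_eq_if_tails_eq)
      show "sets P' = sets borel" "sets P = sets borel"
        using P P' by (simp_all add: coupling_def)
      show "finite_measure P'"
        using P' by (simp add: coupling_def prob_space_def)
      show "emeasure P' ({x<..} \<times> B) = emeasure P ({x<..} \<times> B)" if "B \<in> sets borel" for x B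
        using P(2)[OF that, of x] P' that by simp
    qed
  qed (use P dir in auto)
  moreover have "\<theta> = shadow x"
    if "\<theta> \<in> S_set \<mu> \<nu> x" "\<forall>\<theta>'\<in>S_set \<mu> \<nu> x. \<theta> \<preceq>\<^sub>s\<^sub>t \<theta>'" for \<theta> x
    using that shadow_in_S_set[of x] shadow_least[OF that(1)]
    by (intro st_le_antisym[OF S_setD(1)[OF that(1)] finite_borel_measure_shadow]) auto
  ultimately show ?thesis
    unfolding nu_meas_eq_shadow using shadow_in_S_set shadow_least by blast
qed

end
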